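(* Let $p$ be a prime, $G$ a finite additive abelian $p$-group, and $q$ a power of $p$ with $q>d^*(G)$. (i) Let $A=\{a_s(n_s)\}_{s=1}^k$ (with $a_s\in\mathbb Z$, $n_s\in\mathbb Z^+$) satisfy $d^*(G)+q\le w_A(x)\le 2q$ for all $x\in\mathbb Z$. Then for any $c_1,\ldots,c_k\in G$ there is $I\subseteq\{1,\ldots,k\}$ with $\sum_{s\in I}c_s=0$ and $\sum_{s\in I}1/n_s=q$. (ii) Let $A=\{a_s(n_s)\}_{s=1}^k$ be an exact $3q$-cover of $\mathbb Z$. Then for any $c_1,\ldots,c_k\in G\oplus G$ with $\sum_{s=1}^kc_s=0$ there is $I\subseteq\{1,\ldots,k\}$ with $\sum_{s\in I}c_s=0$ and $\sum_{s\in I}1/n_s=q$.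
   Context: For $a\in\mathbb Z$ and $n\in\mathbb Z^+$, $a(n)=a+n\mathbb Z$. For $A=\{a_s(n_s)\}_{s=1}^k$, $w_A(x)=|\{1\le s\le k: x\in a_s(n_s)\}|$; $A$ is an exact $m$-cover of $\mathbb Z$ if $w_A(x)=m$ for all $x\in\mathbb Z$. For a finite abelian group $G$ with $|G|>1$, write $G\cong\mathbb Z_{d_1}\oplus\cdots\oplus\mathbb Z_{d_r}$ with $1<d_1\mid d_2\mid\cdots\mid d_r$ and set $d^*(G)=\sum_{i=1}^r(d_i-1)$; if $|G|=1$ set $d^*(G)=0$. *)

theory Defs
  imports Complex_Main "HOL-Algebra.FiniteProduct" "HOL-Algebra.Product_Groups" "HOL-Computational_Algebra.Primes"
begin

definition residue_class :: "int \<Rightarrow> nat \<Rightarrow> int set" where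
  "residue_class a n = {a + int n * t | t. t \<in> UNIV}"

text \<open>A finite system of residue classes \<open>a\<^sub>s(n\<^sub>s)\<close>, \<open>1 \<le> s \<le> k\<close>, is given by its length \<open>k\<close> and
  the functions \<open>a\<close>, \<open>n\<close>, whose values outside \<open>{1..k}\<close> play no role; repeated classes are allowed.\<close>

definition covering_function :: "nat \<Rightarrow> (nat \<Rightarrow> int) \<Rightarrow> (nat \<Rightarrow> nat) \<Rightarrow> int \<Rightarrow> nat" where
  "covering_function k a n x = card {s \<in> {1..k}. x \<in> residue_class (a s) (n s)}"

definition exact_cover :: "nat \<Rightarrow> nat \<Rightarrow> (nat \<Rightarrow> int) \<Rightarrow> (nat \<Rightarrow> nat) \<Rightarrow> bool" where
  "exact_cover m k a n \<longleftrightarrow> (\<forall>x. covering_function k a n x = m)"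

text \<open>Abelian groups are objects of the locale \<open>comm_group\<close>, so the group operation is written
  multiplicatively: the zero element is \<open>\<one>\<^bsub>G\<^esub>\<close> and sums are \<open>finprod\<close>.

  The list \<open>ds = [d\<^sub>1, \<dots>, d\<^sub>r]\<close> below satisfies \<open>1 < d\<^sub>1 dvd \<dots> dvd d\<^sub>r\<close>.
  The empty list belongs exactly to the trivial groups.\<close>

definition invariant_factors :: "('g, 'm) monoid_scheme \<Rightarrow> nat list \<Rightarrow> bool" where
  "invariant_factors G ds \<longleftrightarrow>
     (\<forall>d \<in> set ds. 1 < d) \<and> sorted_wrt (dvd) ds \<and>
     G \<cong> product_group {..<length ds} (\<lambda>i. integer_mod_group (ds ! i))"

text \<open>By the structure theorem a finite abelian group has exactly one list of invariant factors,
  so the choice is unique. For the trivial group the sum is empty, which gives the value 0.\<close>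

definition d_star :: "('g, 'm) monoid_scheme \<Rightarrow> nat" where
  "d_star G = (\<Sum>d\<leftarrow>(SOME ds. invariant_factors G ds). d - 1)"

end

theory Submission
  imports Defs "HOL-Algebra.Multiplicative_Group" "HOL-Number_Theory.Cong" "Jordan_Normal_Form.Char_Poly"
begin

text \<open>
  Let \<open>F\<close> be a product of fewer than \<open>min w\<^sub>A\<close> affine forms in the indicator variables of \<open>I\<close>. Since
  \<open>\<Sum>\<^sub>I F(I) \<Prod>\<^sub>s\<^sub>\<in>\<^sub>I (- e((a\<^sub>s - x)/n\<^sub>s))\<close> vanishes for every integer \<open>x\<close>, averaging over \<open>x\<close> shows that
  the part of \<open>\<Sum>\<^sub>I F(I) \<Prod>\<^sub>s\<^sub>\<in>\<^sub>I (- e(a\<^sub>s/n\<^sub>s))\<close> with integral \<open>\<Sum>\<^sub>s\<^sub>\<in>\<^sub>I 1/n\<^sub>s\<close> vanishes. Now let \<open>F\<close> be a product of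
  binomials \<open>b(I) + d - 1\<close> over \<open>d - 1\<close>, one for each cyclic factor of the group and one for
  \<open>\<Sum>\<^sub>s\<^sub>\<in>\<^sub>I 1/n\<^sub>s\<close> with \<open>d = q\<close>. Such a binomial is divisible by \<open>p\<close> unless \<open>d\<close> divides \<open>b(I)\<close>. If no
  nonempty \<open>I\<close> satisfied all the divisibilities, then \<open>1 + p \<epsilon> = 0\<close> for an algebraic integer \<open>\<epsilon>\<close>, which
  is impossible. So some nonempty zero-sum \<open>I\<close> has \<open>\<Sum>\<^sub>s\<^sub>\<in>\<^sub>I 1/n\<^sub>s\<close> divisible by \<open>q\<close>. When the cover is exact,
  one class is deleted first, so that the total of the \<open>1/n\<^sub>s\<close> does not qualify; in part (ii) a
  set of weight \<open>2 q\<close> is then replaced by its complement.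
\<close>

(* Polynomial.order would otherwise capture the order of a group. *)
hide_const (open) Polynomial.order

section \<open>Integer combinations of roots of unity\<close>

text \<open>An eigenvalue of an integer matrix is a root of its characteristic polynomial, which is
  monic with integer coefficients.\<close>

lemma algebraic_int_sum_powers_root_of_unity:
  fixes \<zeta> :: complex and z :: "nat \<Rightarrow> int"
  assumes M: "M > 0" and \<zeta>: "\<zeta> ^ M = 1"
  shows "algebraic_int (\<Sum>j<M. of_int (z j) * \<zeta> ^ j)"
proof -
  define \<alpha> where "\<alpha> = (\<Sum>j<M. of_int (z j) * \<zeta> ^ j)"
  \<comment> \<open>The index is \<open>j - i\<close> modulo \<open>M\<close>; adding
    \<open>M\<close> first keeps the subtraction of naturals from truncating.\<close>
  define A where "A = mat M M (\<lambda>(i, j). z ((j + M - i) mod M))"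
  define B where "B = map_mat (of_int :: int \<Rightarrow> complex) A"
  define v where "v = vec M (\<lambda>i. \<zeta> ^ i)"
  have A: "A \<in> carrier_mat M M" and B: "B \<in> carrier_mat M M"
    by (auto simp: A_def B_def)
  have mod_pow: "\<zeta> ^ (k mod M) = \<zeta> ^ k" for k
  proof -
    have "\<zeta> ^ k = \<zeta> ^ (M * (k div M) + k mod M)" by simp
    also have "\<dots> = \<zeta> ^ (k mod M)" by (simp only: power_add power_mult \<zeta>) simp
    finally show ?thesis by simp
  qed
  \<comment> \<open>\<open>\<alpha>\<close> is an eigenvalue of the integral circulant matrix with first row \<open>z\<close>.\<close>
  have "B *\<^sub>v v = \<alpha> \<cdot>\<^sub>v v"
  proof (rule eq_vecI)
    fix i assume "i < dim_vec (\<alpha> \<cdot>\<^sub>v v)"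
    then have i: "i < M" by (simp add: v_def)
    have bij: "bij_betw (\<lambda>j. (j + i) mod M) {..<M} {..<M}"
    proof (rule bij_betwI[where g = "\<lambda>j. (j + M - i) mod M"])
      show "(\<lambda>j. (j + i) mod M) \<in> {..<M} \<rightarrow> {..<M}" "(\<lambda>j. (j + M - i) mod M) \<in> {..<M} \<rightarrow> {..<M}"
        using M by auto
      show "((x + i) mod M + M - i) mod M = x" if "x \<in> {..<M}" for x
        using that i by (cases "x + i < M") (auto simp: mod_if)
      show "((y + M - i) mod M + i) mod M = y" if "y \<in> {..<M}" for y
        using that i by (cases "y + M - i < M") (auto simp: mod_if)
    qed
    have "(B *\<^sub>v v) $ i = (\<Sum>j<M. of_int (z ((j + M - i) mod M)) * \<zeta> ^ j)"
      using i by (simp add: B_def A_def v_def scalar_prod_def atLeast0LessThan)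
    also have "\<dots> = (\<Sum>j<M. of_int (z (((j + i) mod M + M - i) mod M)) * \<zeta> ^ ((j + i) mod M))"
      by (rule sum.reindex_bij_betw[OF bij, symmetric])
    also have "\<dots> = (\<Sum>j<M. of_int (z j) * \<zeta> ^ (j + i))"
    proof (rule sum.cong[OF refl])
      fix j assume "j \<in> {..<M}"
      then have "((j + i) mod M + M - i) mod M = j"
        using i by (cases "j + i < M") (auto simp: mod_if)
      then show "of_int (z (((j + i) mod M + M - i) mod M)) * \<zeta> ^ ((j + i) mod M)
        = of_int (z j) * \<zeta> ^ (j + i)" by (simp only: mod_pow)
    qed
    also have "\<dots> = \<alpha> * \<zeta> ^ i"
      by (simp add: \<alpha>_def sum_distrib_right power_add mult.assoc)
    finally show "(B *\<^sub>v v) $ i = (\<alpha> \<cdot>\<^sub>v v) $ i" using i by (simp add: v_def)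
  qed (simp add: B_def A_def v_def)
  moreover have "v \<noteq> 0\<^sub>v M"
  proof
    assume "v = 0\<^sub>v M"
    then have "v $ 0 = 0" using M by simp
    then show False using M by (simp add: v_def)
  qed
  ultimately have "eigenvalue B \<alpha>"
    unfolding eigenvalue_def eigenvector_def using B by (intro exI[of _ v]) (auto simp: v_def)
  then have "poly (char_poly B) \<alpha> = 0"
    using eigenvalue_root_char_poly[OF B] by simp
  moreover have "char_poly B = map_poly of_int (char_poly A)"
    unfolding B_def by (rule of_int_hom.char_poly_hom[OF A])
  moreover have "lead_coeff (char_poly A) = 1"
    using degree_monic_char_poly[OF A] by simp
  ultimately show ?thesis
    unfolding \<alpha>_def[symmetric] algebraic_int_altdef_ipoly by metis
qed

text \<open>All \<open>M\<close>-th roots of unity are powers of \<open>cis (2 * pi / M)\<close>, so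
  grouping the terms by exponent reduces to powers of a single root.\<close>

lemma algebraic_int_sum_roots_of_unity:
  fixes w :: "'i \<Rightarrow> complex" and z :: "'i \<Rightarrow> int"
  assumes M: "M > 0" and w: "\<And>i. i \<in> Q \<Longrightarrow> w i ^ M = 1" and fin: "finite Q"
  shows "algebraic_int (\<Sum>i\<in>Q. of_int (z i) * w i)"
proof -
  define \<zeta> where "\<zeta> = cis (2 * pi / real M)"
  have \<zeta>: "\<zeta> ^ M = 1" using M by (simp add: \<zeta>_def DeMoivre)
  have "\<exists>k<M. w i = \<zeta> ^ k" if "i \<in> Q" for i
  proof -
    have "w i \<in> {z. z ^ M = 1}" using w[OF that] by simp
    also have "\<dots> = (\<lambda>k. cis (2 * pi * real k / real M)) ` {..<M}"
      using bij_betw_imp_surj_on[OF bij_betw_roots_unity[OF M]] by simp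
    finally show ?thesis by (auto simp: \<zeta>_def DeMoivre mult_ac)
  qed
  then obtain k where k: "\<And>i. i \<in> Q \<Longrightarrow> k i < M \<and> w i = \<zeta> ^ k i" by metis
  have "(\<Sum>i\<in>Q. of_int (z i) * w i) = (\<Sum>j<M. \<Sum>i\<in>{i\<in>Q. k i = j}. of_int (z i) * w i)"
    by (rule sum.group[symmetric]) (use fin k in auto)
  also have "\<dots> = (\<Sum>j<M. of_int (\<Sum>i\<in>{i\<in>Q. k i = j}. z i) * \<zeta> ^ j)"
    using k by (auto intro!: sum.cong simp: sum_distrib_right)
  finally show ?thesis
    using algebraic_int_sum_powers_root_of_unity[OF M \<zeta>] by (simp only:)
qed

section \<open>Vanishing sums over subsets\<close>

lemma sum_Pow_prod_uminus:
  fixes u :: "'s \<Rightarrow> 'a :: comm_ring_1"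
  assumes "finite S"
  shows "(\<Sum>I\<in>Pow S. \<Prod>s\<in>I. - u s) = (\<Prod>s\<in>S. 1 - u s)"
  using prod_add[OF assms, of "\<lambda>s. - u s" "\<lambda>_. 1"] by simp

text \<open>Induction on the number of forms. With none left, the sum is the product of the
  \<open>1 - u s\<close>, which has a zero factor. Otherwise the first form is multiplied out: its
  constant leaves a shorter list, and its summand \<open>l s\<close> restricts the sum to the sets
  containing \<open>s\<close>, which is the same problem on \<open>S - {s}\<close> with one form
  fewer.\<close>

lemma alternating_sum_affine_eq_0:
  fixes u :: "'s \<Rightarrow> 'a :: {comm_ring_1, ring_no_zero_divisors}"
    and L :: "('a \<times> ('s \<Rightarrow> 'a)) list"
  assumes "finite S" and "length L < card {s\<in>S. u s = 1}"
  shows "(\<Sum>I\<in>Pow S. (\<Prod>s\<in>I. - u s) * (\<Prod>(\<alpha>, l)\<leftarrow>L. \<alpha> + sum l I)) = 0"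
  using assms
proof (induction "length L" arbitrary: L S)
  case 0
  then have "{s\<in>S. u s = 1} \<noteq> {}" by (metis card.empty less_nat_zero_code)
  then have "\<exists>s\<in>S. 1 - u s = 0" by auto
  with 0 show ?case by (auto simp: sum_Pow_prod_uminus prod_zero)
next
  case (Suc d)
  then obtain \<alpha> l L' where L: "L = (\<alpha>, l) # L'" and len: "length L' = d"
    by (metis Suc_length_conv surj_pair)
  define P where "P = (\<lambda>L'' I. \<Prod>(\<alpha>, l)\<leftarrow>(L'' :: ('a \<times> ('s \<Rightarrow> 'a)) list). \<alpha> + sum l I)"
  define v where "v = (\<lambda>I. \<Prod>s\<in>I. - u s)"
  have inner: "(\<Sum>I\<in>{I\<in>Pow S. s \<in> I}. v I * P L' I) = 0" if s: "s \<in> S" for s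
  proof -
    \<comment> \<open>The contribution of the fixed element \<open>s\<close> is absorbed into the
      constants of the forms.\<close>
    define L'' where "L'' = map (\<lambda>(\<alpha>, l). (\<alpha> + l s, l)) L'"
    have "{I\<in>Pow S. s \<in> I} = insert s ` Pow (S - {s})"
    proof (rule equalityI; rule subsetI)
      fix I assume "I \<in> {I\<in>Pow S. s \<in> I}"
      then have "I = insert s (I - {s})" "I - {s} \<in> Pow (S - {s})" by auto
      then show "I \<in> insert s ` Pow (S - {s})" by blast
    qed (use s in auto)
    moreover have inj: "inj_on (insert s) (Pow (S - {s}))"
      by (auto simp: inj_on_def)
    ultimately have "(\<Sum>I\<in>{I\<in>Pow S. s \<in> I}. v I * P L' I)
      = (\<Sum>J\<in>Pow (S - {s}). v (insert s J) * P L' (insert s J))"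
      by (simp add: sum.reindex[OF inj])
    also have "\<dots> = (\<Sum>J\<in>Pow (S - {s}). - u s * (v J * P L'' J))"
    proof (rule sum.cong[OF refl])
      fix J assume J: "J \<in> Pow (S - {s})"
      then have fJ: "finite J" and sJ: "s \<notin> J" using Suc.prems(1) by (auto intro: finite_subset)
      have "v (insert s J) = - u s * v J" using fJ sJ by (simp add: v_def)
      moreover have "P L' (insert s J) = P L'' J"
        unfolding P_def L''_def using fJ sJ
        by (auto intro!: arg_cong[where f = prod_list] simp: algebra_simps)
      ultimately show "v (insert s J) * P L' (insert s J) = - u s * (v J * P L'' J)" by simp
    qed
    also have "\<dots> = - u s * (\<Sum>J\<in>Pow (S - {s}). v J * P L'' J)"
      by (rule sum_distrib_left[symmetric])
    also have "(\<Sum>J\<in>Pow (S - {s}). v J * P L'' J) = 0"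
      unfolding v_def P_def
    proof (rule Suc.hyps(1))
      show "d = length L''" by (simp add: L''_def len)
      \<comment> \<open>Deleting \<open>s\<close> loses at most one index with
        \<open>u t = 1\<close>, and one form has been dropped as well, so the strict inequality
        survives.\<close>
      have "card {t\<in>S. u t = 1} \<le> card (insert s {t\<in>S - {s}. u t = 1})"
        using Suc.prems(1) by (intro card_mono) auto
      also have "\<dots> \<le> Suc (card {t\<in>S - {s}. u t = 1})" by (rule card_insert_le_m1) auto
      finally show "length L'' < card {t\<in>S - {s}. u t = 1}"
        using Suc.prems(2) len by (simp add: L L''_def)
    qed (use Suc.prems in auto)
    finally show ?thesis by simp
  qed
  have "(\<Sum>I\<in>Pow S. v I * P L I) = (\<Sum>I\<in>Pow S. \<alpha> * (v I * P L' I) + (\<Sum>s\<in>I. l s) * (v I * P L' I))"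
    by (simp add: P_def L algebra_simps)
  also have "\<dots> = \<alpha> * (\<Sum>I\<in>Pow S. v I * P L' I) + (\<Sum>I\<in>Pow S. \<Sum>s\<in>I. l s * (v I * P L' I))"
    by (simp add: sum.distrib sum_distrib_left sum_distrib_right)
  also have "(\<Sum>I\<in>Pow S. v I * P L' I) = 0"
    unfolding v_def P_def by (rule Suc.hyps(1)) (use Suc.prems len L in auto)
  also have "(\<Sum>I\<in>Pow S. \<Sum>s\<in>I. l s * (v I * P L' I))
    = (\<Sum>I\<in>Pow S. \<Sum>s\<in>{s\<in>S. s \<in> I}. l s * (v I * P L' I))"
    by (rule sum.cong[OF refl], rule sum.cong) auto
  also have "\<dots> = (\<Sum>s\<in>S. \<Sum>I\<in>{I\<in>Pow S. s \<in> I}. l s * (v I * P L' I))"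
    by (rule sum.swap_restrict) (use Suc.prems(1) in auto)
  also have "\<dots> = (\<Sum>s\<in>S. l s * (\<Sum>I\<in>{I\<in>Pow S. s \<in> I}. v I * P L' I))"
    by (simp add: sum_distrib_left)
  also have "\<dots> = 0" using inner by simp
  finally show ?case by (simp add: v_def P_def)
qed

section \<open>Averaging over a full period\<close>

lemma sum_powers_root_of_unity:
  fixes w :: complex
  assumes "w ^ N = 1"
  shows "(\<Sum>x<N. w ^ x) = (if w = 1 then of_nat N else 0)"
  using assms by (simp add: sum_gp_strict)

lemma cis_2pi_eq_1_iff: "cis (2 * pi * x) = 1 \<longleftrightarrow> x \<in> \<int>"
proof
  assume "cis (2 * pi * x) = 1"
  then have "cos (2 * pi * x) = 1" by (simp add: complex_eq_iff)
  then obtain k :: int where "2 * pi * x = of_int k * 2 * pi"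
    using cos_one_2pi_int by auto
  then have "x = of_int k" by simp
  then show "x \<in> \<int>" by simp
qed (auto elim!: Ints_cases)

lemma cis_sum: "cis (sum f I) = (\<Prod>s\<in>I. cis (f s))"
  by (induction I rule: infinite_finite_induct) (simp_all add: cis_mult[symmetric])

text \<open>With \<open>u s = cis (2 * pi * (a s - x) / n s)\<close> the preceding vanishing holds
  for every \<open>x\<close>. The term of \<open>I\<close> depends on \<open>x\<close> only through
  a power of the root of unity attached to \<open>\<sigma> I\<close>, so summing over a period
  removes every \<open>I\<close> with \<open>\<sigma> I\<close> not integral.\<close>

lemma sum_affine_cover_eq_0:
  fixes a :: "'s \<Rightarrow> int" and n :: "'s \<Rightarrow> nat" and L :: "(complex \<times> ('s \<Rightarrow> complex)) list"
  assumes S: "finite S" and n: "\<And>s. s \<in> S \<Longrightarrow> n s > 0"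
    and cover: "\<And>x. length L < card {s\<in>S. x \<in> residue_class (a s) (n s)}"
  shows "(\<Sum>I | I \<subseteq> S \<and> (\<Sum>s\<in>I. 1 / real (n s)) \<in> \<int>.
           (\<Prod>s\<in>I. - cis (2 * pi * a s / n s)) * (\<Prod>(\<alpha>, l)\<leftarrow>L. \<alpha> + sum l I)) = 0"
proof -
  \<comment> \<open>A common multiple of the moduli, hence a period of all the exponentials
    involved.\<close>
  define N where "N = (\<Prod>s\<in>S. n s)"
  have N: "N > 0" unfolding N_def using n by (simp add: prod_pos)
  define F where "F I = (\<Prod>(\<alpha>, l)\<leftarrow>L. \<alpha> + sum l I)" for I
  define v where "v I = (\<Prod>s\<in>I. - cis (2 * pi * a s / n s))" for I
  define \<sigma> where "\<sigma> I = (\<Sum>s\<in>I. 1 / real (n s))" for I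
  have avg: "(\<Sum>x<N. \<Prod>s\<in>I. - cis (2 * pi * ((a s - int x) / n s)))
      = (if \<sigma> I \<in> \<int> then of_nat N * v I else 0)" if I: "I \<subseteq> S" for I
  proof -
    \<comment> \<open>The factor by which the product over \<open>I\<close> changes when
      \<open>x\<close> increases by one.\<close>
    define w where "w = cis (2 * pi * (- \<sigma> I))"
    have "(\<Prod>s\<in>I. - cis (2 * pi * ((a s - int x) / n s))) = v I * w ^ x" for x
    proof -
      have "w ^ x = cis (\<Sum>s\<in>I. - (2 * pi * real x / n s))"
        by (simp add: w_def DeMoivre \<sigma>_def sum_distrib_left sum_negf mult_ac)
      also have "\<dots> = (\<Prod>s\<in>I. cis (- (2 * pi * real x / n s)))"
        by (rule cis_sum)
      finally show ?thesis
        by (simp add: v_def prod.distrib[symmetric] cis_mult diff_divide_distrib algebra_simps)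
    qed
    then have "(\<Sum>x<N. \<Prod>s\<in>I. - cis (2 * pi * ((a s - int x) / n s))) = v I * (\<Sum>x<N. w ^ x)"
      by (simp add: sum_distrib_left)
    moreover have "w ^ N = 1"
    proof -
      have "real N * (1 / real (n s)) \<in> \<int>" if "s \<in> I" for s
      proof -
        have "n s dvd N" unfolding N_def using that I S by (intro dvd_prodI) auto
        then have "real N / real (n s) = real (N div n s)" by (simp add: real_of_nat_div)
        then show ?thesis by simp
      qed
      then have "- (\<Sum>s\<in>I. real N * (1 / real (n s))) \<in> \<int>" by (intro Ints_minus Ints_sum)
      then have "real N * (- \<sigma> I) \<in> \<int>" by (simp add: \<sigma>_def sum_distrib_left)
      then have "cis (2 * pi * (real N * (- \<sigma> I))) = 1" by (simp only: cis_2pi_eq_1_iff)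
      then show ?thesis by (simp add: w_def DeMoivre mult_ac)
    qed
    moreover have "w = 1 \<longleftrightarrow> \<sigma> I \<in> \<int>"
      unfolding w_def cis_2pi_eq_1_iff by (metis Ints_minus minus_minus)
    ultimately show ?thesis by (simp add: sum_powers_root_of_unity)
  qed
  have "(\<Sum>I\<in>Pow S. (\<Prod>s\<in>I. - cis (2 * pi * ((a s - int x) / n s))) * F I) = 0" for x
    unfolding F_def
  proof (rule alternating_sum_affine_eq_0[OF S])
    have "{s\<in>S. int x \<in> residue_class (a s) (n s)} \<subseteq> {s\<in>S. cis (2 * pi * ((a s - int x) / n s)) = 1}"
    proof safe
      fix s assume "s \<in> S" "int x \<in> residue_class (a s) (n s)"
      then obtain t where "int x = a s + int (n s) * t" and "n s > 0"
        using n by (auto simp: residue_class_def)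
      then have "(a s - int x) / n s = of_int (- t)" by simp
      then show "cis (2 * pi * ((a s - int x) / n s)) = 1"
        by (simp only: cis_2pi_eq_1_iff Ints_of_int)
    qed
    then have "card {s\<in>S. int x \<in> residue_class (a s) (n s)} \<le> card {s\<in>S. cis (2 * pi * ((a s - int x) / n s)) = 1}"
      by (rule card_mono[rotated]) (use S in auto)
    with cover[of "int x"] show "length L < card {s\<in>S. cis (2 * pi * ((a s - int x) / n s)) = 1}"
      by linarith
  qed
  then have "0 = (\<Sum>x<N. \<Sum>I\<in>Pow S. (\<Prod>s\<in>I. - cis (2 * pi * ((a s - int x) / n s))) * F I)" by simp
  also have "\<dots> = (\<Sum>I\<in>Pow S. (\<Sum>x<N. \<Prod>s\<in>I. - cis (2 * pi * ((a s - int x) / n s))) * F I)"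
    by (subst sum.swap) (simp add: sum_distrib_right)
  also have "\<dots> = (\<Sum>I\<in>Pow S. if \<sigma> I \<in> \<int> then of_nat N * v I * F I else 0)"
    using avg by (intro sum.cong) auto
  also have "\<dots> = (\<Sum>I\<in>{I\<in>Pow S. \<sigma> I \<in> \<int>}. of_nat N * v I * F I)"
    using S by (intro sum.inter_filter[symmetric]) simp
  also have "\<dots> = of_nat N * (\<Sum>I | I \<subseteq> S \<and> \<sigma> I \<in> \<int>. v I * F I)"
    by (simp add: sum_distrib_left mult.assoc)
  finally show ?thesis using N by (simp add: \<sigma>_def v_def F_def)
qed

section \<open>Binomial coefficients modulo a prime\<close>

text \<open>This exhibits the binomial as a product of \<open>k\<close> affine forms in
  \<open>m\<close>, the shape to which the vanishing sums apply.\<close>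

lemma of_nat_binomial_eq_prod:
  "of_nat ((m + k) choose k) = (\<Prod>j = 1..k. 1 + of_nat m / of_nat j :: 'a :: field_char_0)"
proof (induction k)
  case (Suc k)
  have "of_nat (Suc k) * of_nat ((m + Suc k) choose Suc k)
      = (of_nat (Suc (m + k)) * of_nat ((m + k) choose k) :: 'a)"
    using arg_cong[OF Suc_times_binomial[of k "m + k"], of "of_nat :: nat \<Rightarrow> 'a"] 
    by (simp only: of_nat_mult add_Suc_right)
  then have "of_nat ((m + Suc k) choose Suc k)
      = (of_nat (Suc (m + k)) / of_nat (Suc k) * of_nat ((m + k) choose k) :: 'a)"
    by (simp add: field_simps del: of_nat_Suc binomial_Suc_Suc)
  also have "of_nat (Suc (m + k)) / of_nat (Suc k) = (1 + of_nat m / of_nat (Suc k) :: 'a)"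
    by (simp add: field_simps del: of_nat_Suc) simp
  finally show ?case by (simp add: Suc mult.commute)
qed simp

text \<open>In \<open>p ^ h * ((m + p ^ h) choose p ^ h) = (m + p ^ h) * ((m + (p ^ h - 1)) choose
  (p ^ h - 1))\<close>, a last factor prime to \<open>p\<close> would force \<open>p ^ h\<close> to
  divide \<open>m + p ^ h\<close>.\<close>

lemma prime_dvd_binomial_shift:
  fixes p :: nat
  assumes p: "prime p" and m: "\<not> p ^ h dvd m"
  shows "p dvd ((m + (p ^ h - 1)) choose (p ^ h - 1))"
proof (rule ccontr)
  assume "\<not> p dvd ((m + (p ^ h - 1)) choose (p ^ h - 1))"
  then have "coprime (p ^ h) ((m + (p ^ h - 1)) choose (p ^ h - 1))"
    using p by (simp add: prime_imp_coprime)
  moreover have "p ^ h dvd (m + p ^ h) * ((m + (p ^ h - 1)) choose (p ^ h - 1))"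
  proof -
    have "p ^ h > 0" using p by (simp add: prime_gt_0_nat)
    then have "p ^ h * ((m + p ^ h) choose p ^ h) = (m + p ^ h) * ((m + (p ^ h - 1)) choose (p ^ h - 1))"
      using Suc_times_binomial[of "p ^ h - 1" "m + (p ^ h - 1)"]
      by (metis Suc_diff_1 add_Suc_right)
    then show ?thesis by (metis dvd_triv_left)
  qed
  ultimately have "p ^ h dvd m + p ^ h" using coprime_dvd_mult_left_iff by blast
  with m show False by simp
qed

text \<open>A pair \<open>(d, b)\<close> stands for the condition that \<open>d\<close> divides
  \<open>sum b I\<close>, and costs \<open>d - 1\<close> forms. The weights are real so that
  \<open>1 / n s\<close> can be one of them; \<open>Nats\<close> makes their sums natural on the
  subsets that survive the averaging.\<close>

lemma exists_nonempty_subset_dvd: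
  fixes a :: "'s \<Rightarrow> int" and n :: "'s \<Rightarrow> nat" and D :: "(nat \<times> ('s \<Rightarrow> real)) list"
  assumes p: "prime p" and S: "finite S" and n: "\<And>s. s \<in> S \<Longrightarrow> n s > 0"
    and D: "\<And>d b. (d, b) \<in> set D \<Longrightarrow> \<exists>h. d = p ^ h"
    and cover: "\<And>x. (\<Sum>(d, b)\<leftarrow>D. d - 1) < card {s\<in>S. x \<in> residue_class (a s) (n s)}"
    and Nats: "\<And>d b I. (d, b) \<in> set D \<Longrightarrow> I \<subseteq> S \<Longrightarrow> (\<Sum>s\<in>I. 1 / real (n s)) \<in> \<int> \<Longrightarrow> sum b I \<in> \<nat>"
  shows "\<exists>I\<subseteq>S. I \<noteq> {} \<and> (\<forall>(d, b)\<in>set D. \<exists>m. sum b I = real (d * m))"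
proof (rule ccontr)
  assume no: "\<not> ?thesis"
  define \<G> where "\<G> = {I. I \<subseteq> S \<and> (\<Sum>s\<in>I. 1 / real (n s)) \<in> \<int>}"
  define c where "c I = (\<Prod>(d, b)\<leftarrow>D. (nat \<lfloor>sum b I\<rfloor> + (d - 1)) choose (d - 1))" for I
  define w where "w I = (\<Prod>s\<in>I. - cis (2 * pi * a s / n s))" for I
  \<comment> \<open>The \<open>d - 1\<close> factors \<open>1 + sum b I / j\<close> of the binomial
    of each pair, for \<open>0 < j < d\<close>.\<close>
  define L where "L = concat (map (\<lambda>(d, b :: 's \<Rightarrow> real).
    map (\<lambda>j. (1 :: complex, \<lambda>s. of_real (b s) / of_nat j :: complex)) [1..<d]) D)"
  have fin: "finite \<G>" using S by (auto simp: \<G>_def)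
  \<comment> \<open>Taking floors in \<open>c\<close> loses nothing on \<open>\<G>\<close>, where
    these sums are naturals.\<close>
  have floor: "of_nat (nat \<lfloor>sum b I\<rfloor>) = sum b I" if "(d, b) \<in> set D" "I \<in> \<G>" for d b I
    using Nats[of d b I] that by (auto simp: \<G>_def elim!: Nats_cases)
  have c: "(\<Prod>(\<alpha>, l)\<leftarrow>L. \<alpha> + sum l I) = of_nat (c I)" if I: "I \<in> \<G>" for I
  proof -
    have "(\<Prod>j\<leftarrow>[1..<d]. 1 + (\<Sum>s\<in>I. of_real (b s) / of_nat j))
      = (of_nat ((nat \<lfloor>sum b I\<rfloor> + (d - 1)) choose (d - 1)) :: complex)" if "(d, b) \<in> set D" for d b
    proof -
      have "(\<Prod>j\<leftarrow>[1..<d]. 1 + (\<Sum>s\<in>I. of_real (b s) / of_nat j))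
          = (\<Prod>j = 1..d - 1. 1 + of_real (sum b I) / of_nat j :: complex)"
        by (subst prod.distinct_set_conv_list[symmetric])
          (auto simp: sum_divide_distrib[symmetric] intro!: prod.cong)
      also have "of_real (sum b I) = (of_nat (nat \<lfloor>sum b I\<rfloor>) :: complex)"
        using floor[OF that I] by (metis of_real_of_nat_eq)
      finally show ?thesis by (simp add: of_nat_binomial_eq_prod)
    qed
    then show ?thesis
      unfolding L_def c_def by (induction D) (auto simp: comp_def)
  qed
  have "length L = (\<Sum>(d, b)\<leftarrow>D. d - 1)"
    unfolding L_def by (induction D) auto
  then have "(\<Sum>I\<in>\<G>. w I * (\<Prod>(\<alpha>, l)\<leftarrow>L. \<alpha> + sum l I)) = 0"
    unfolding \<G>_def w_def by (intro sum_affine_cover_eq_0 S n) (use cover in auto)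
  then have "(\<Sum>I\<in>\<G>. w I * of_nat (c I)) = 0" using c by simp
  moreover have "{} \<in> \<G>" by (simp add: \<G>_def)
  \<comment> \<open>For the empty set every binomial has the form
    \<open>(d - 1) choose (d - 1)\<close>; this term supplies the 1 in the final
    contradiction.\<close>
  moreover have "c {} = 1" unfolding c_def by (induction D) auto
  ultimately have *: "1 + (\<Sum>I\<in>\<G> - {{}}. w I * of_nat (c I)) = 0"
    using fin by (simp add: sum.remove w_def)
  \<comment> \<open>By assumption \<open>I\<close> violates the condition of some pair, and the
    binomial of that pair is then divisible by \<open>p\<close>.\<close>
  have "p dvd c I" if I: "I \<in> \<G> - {{}}" for I
  proof -
    have "\<not> (\<forall>(d, b)\<in>set D. \<exists>m. sum b I = real (d * m))"
      using no I unfolding \<G>_def by blast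
    then obtain d b where db: "(d, b) \<in> set D" "\<nexists>m. sum b I = real (d * m)"
      by blast
    have "\<not> d dvd nat \<lfloor>sum b I\<rfloor>"
      using floor[OF db(1), of I] I db(2) by (metis DiffD1 dvdE)
    then have "p dvd ((nat \<lfloor>sum b I\<rfloor> + (d - 1)) choose (d - 1))"
      using D[OF db(1)] prime_dvd_binomial_shift[OF p] by auto
    moreover have "((nat \<lfloor>sum b I\<rfloor> + (d - 1)) choose (d - 1)) dvd c I"
      unfolding c_def by (rule prod_list_dvd) (use db(1) in force)
    ultimately show ?thesis by (rule dvd_trans)
  qed
  define \<epsilon> where "\<epsilon> = (\<Sum>I\<in>\<G> - {{}}. of_int (int (c I div p)) * w I)"
  have "(\<Sum>I\<in>\<G> - {{}}. w I * of_nat (c I)) = of_nat p * \<epsilon>"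
    unfolding \<epsilon>_def sum_distrib_left
  proof (rule sum.cong[OF refl])
    fix I assume "I \<in> \<G> - {{}}"
    then have "c I = p * (c I div p)" using \<open>\<And>I. I \<in> \<G> - {{}} \<Longrightarrow> p dvd c I\<close> by simp
    then have "(of_nat (c I) :: complex) = of_nat p * of_nat (c I div p)" by (metis of_nat_mult)
    then show "w I * of_nat (c I) = of_nat p * (of_int (int (c I div p)) * w I)" by simp
  qed
  with * have \<epsilon>: "1 + of_nat p * \<epsilon> = 0" by simp
  have "algebraic_int \<epsilon>"
    unfolding \<epsilon>_def
  proof (rule algebraic_int_sum_roots_of_unity)
    \<comment> \<open>The product of the moduli annihilates the arguments of the exponentials, and
      the factor 2 the minus signs.\<close>
    show "2 * (\<Prod>s\<in>S. n s) > 0" using n by (simp add: prod_pos)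
    fix I assume I: "I \<in> \<G> - {{}}"
    have "(- cis (2 * pi * a s / n s)) ^ (2 * (\<Prod>s\<in>S. n s)) = 1" if "s \<in> I" for s
    proof -
      have s: "s \<in> S" using that I by (auto simp: \<G>_def)
      then obtain m where m: "(\<Prod>s\<in>S. n s) = n s * m"
        using dvd_prodI[OF S, of s n] by (auto elim: dvdE)
      have "cis (2 * pi * a s / n s) ^ n s = cis (2 * pi * of_int (a s))"
        using n[OF s] by (simp add: DeMoivre)
      also have "\<dots> = 1" by (simp only: cis_2pi_eq_1_iff Ints_of_int)
      finally have "(cis (2 * pi * a s / n s) ^ n s) ^ (2 * m) = 1" by simp
      then show ?thesis by (simp add: m power_mult[symmetric] mult_ac)
    qed
    then show "w I ^ (2 * (\<Prod>s\<in>S. n s)) = 1"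
      unfolding w_def prod_power_distrib by (intro prod.neutral) blast
  qed (use fin in auto)
  \<comment> \<open>A rational algebraic integer is an integer, which \<open>- 1 / p\<close> is
    not.\<close>
  moreover have "\<epsilon> = - 1 / of_nat p" using \<epsilon> p by (simp add: field_simps add_eq_0_iff)
  moreover have "- 1 / of_nat p \<in> (\<rat> :: complex set)" by simp
  ultimately have "\<epsilon> \<in> \<int>" using rational_algebraic_int_is_int by metis
  then obtain k where "\<epsilon> = of_int k" by (elim Ints_cases)
  with \<epsilon> have "of_int (1 + int p * k) = (0 :: complex)" by simp
  then have "int p dvd 1" by (metis add_eq_0_iff dvd_minus_iff dvd_triv_left minus_minus of_int_eq_0_iff)
  with p show False by (simp add: prime_gt_1_nat)
qed

section \<open>Invariant factors of finite abelian p-groups\<close>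

context comm_group
begin

lemma nat_pow_finprod:
  assumes "f \<in> A \<rightarrow> carrier G"
  shows "finprod G f A [^] (k :: nat) = finprod G (\<lambda>x. f x [^] k) A"
  using assms
  by (induction A rule: infinite_finite_induct) (auto simp: nat_pow_distrib Pi_iff)

lemma subgroup_finprod_closed:
  assumes "subgroup H G" "\<And>x. x \<in> A \<Longrightarrow> f x \<in> H"
  shows "finprod G f A \<in> H"
  using assms(2)
proof (induction A rule: infinite_finite_induct)
  case (insert x A)
  then have "f \<in> A \<rightarrow> carrier G" "f x \<in> carrier G"
    using subgroup.mem_carrier[OF assms(1)] by auto
  with insert show ?case using assms(1) by (simp add: subgroup.m_closed)
qed (use assms(1) in \<open>auto simp: subgroup.one_closed\<close>)

lemma generate_insert_Diff:
  assumes "S \<subseteq> carrier G" "y \<in> carrier G" "x \<in> generate G (insert y (S - {x}))"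
  shows "generate G S \<subseteq> generate G (insert y (S - {x}))"
  by (rule generate_subgroup_incl)
    (use assms in \<open>auto intro!: generate_is_subgroup intro: generate.incl\<close>)

text \<open>Take a generating set with the least sum of orders. In a nontrivial relation, factor out the least
  power \<open>p\<^sup>t\<close> occurring in the exponents: what remains is an element \<open>y\<close> of order at most \<open>p\<^sup>t\<close> that can
  replace a generator of larger order.\<close>

lemma independent_generators_exist:
  assumes fin: "finite (carrier G)" and p: "prime p" and ord: "order G = p ^ e"
  obtains S where "S \<subseteq> carrier G" "generate G S = carrier G" "\<one> \<notin> S"
    "\<And>c :: 'a \<Rightarrow> nat. (\<And>x. x \<in> S \<Longrightarrow> c x < ord x) \<Longrightarrow>
       finprod G (\<lambda>x. x [^] c x) S = \<one> \<Longrightarrow> \<forall>x\<in>S. c x = 0"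
proof -
  define gen where "gen S \<longleftrightarrow> S \<subseteq> carrier G \<and> generate G S = carrier G" for S
  have "gen (carrier G)"
    unfolding gen_def using generate_incl[of "carrier G"] by (auto intro: generate.incl)
  then obtain S where S: "gen S" and min: "\<And>S'. gen S' \<Longrightarrow> sum ord S \<le> sum ord S'"
    using ex_has_least_nat[of gen "carrier G" "sum ord"] by blast
  have SG: "S \<subseteq> carrier G" and finS: "finite S"
    using S fin by (auto simp: gen_def intro: finite_subset)
  \<comment> \<open>The set with \<open>y\<close> in place of \<open>x\<close> still generates, so
    its sum of orders cannot be smaller than that of \<open>S\<close>.\<close>
  have exchange: "ord x \<le> ord y"
    if "x \<in> S" "y \<in> carrier G" "x \<in> generate G (insert y (S - {x}))" for x y
  proof -
    have "carrier G \<subseteq> generate G (insert y (S - {x}))"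
      using generate_insert_Diff[OF SG that(2,3)] S by (simp add: gen_def)
    then have "gen (insert y (S - {x}))"
      using generate_incl[of "insert y (S - {x})"] SG that(2) by (auto simp: gen_def)
    then have "sum ord S \<le> sum ord (insert y (S - {x}))" by (rule min)
    also have "\<dots> \<le> ord y + sum ord (S - {x})"
      using finS by (simp add: sum.insert_if)
    finally show ?thesis using that(1) finS by (simp add: sum.remove)
  qed
  \<comment> \<open>Dropping the identity, of order 1, would lower the minimal sum.\<close>
  have "\<one> \<notin> S"
  proof
    assume one: "\<one> \<in> S"
    then have "gen (S - {\<one>})"
      using generate_subgroup_incl[of S "generate G (S - {\<one>})"] S
        generate_incl[of "S - {\<one>}"] generate_is_subgroup[of "S - {\<one>}"]
      by (auto simp: gen_def intro: generate.one generate.incl)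
    then have "sum ord S \<le> sum ord (S - {\<one>})" by (rule min)
    with one finS show False by (simp add: sum.remove)
  qed
  moreover have "\<forall>x\<in>S. c x = 0"
    if c: "\<And>x. x \<in> S \<Longrightarrow> c x < ord x" and rel: "finprod G (\<lambda>x. x [^] c x) S = \<one>"
    for c :: "'a \<Rightarrow> nat"
  proof (rule ccontr)
    assume "\<not> (\<forall>x\<in>S. c x = 0)"
    then have "\<exists>x. x \<in> S \<and> c x \<noteq> 0" by blast
    then obtain j where j: "j \<in> S" "c j \<noteq> 0"
      and jmin: "\<And>x. x \<in> S \<Longrightarrow> c x \<noteq> 0 \<Longrightarrow> multiplicity p (c j) \<le> multiplicity p (c x)"
      using ex_has_least_nat[of "\<lambda>x. x \<in> S \<and> c x \<noteq> 0" _ "\<lambda>x. multiplicity p (c x)"] by blast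
    define t where "t = multiplicity p (c j)"
    define b where "b x = c x div p ^ t" for x
    have cb: "c x = b x * p ^ t" if "x \<in> S" for x
      using jmin[OF that] unfolding b_def t_def
      by (cases "c x = 0") (simp_all add: multiplicity_dvd')
    \<comment> \<open>After division by the full power of \<open>p\<close> in \<open>c j\<close>,
      the exponent \<open>b j\<close> is prime to \<open>p\<close>, whereas \<open>ord j\<close> is
      a power of \<open>p\<close>.\<close>
    have bj: "coprime (b j) (ord j)"
    proof -
      have "\<not> p dvd b j"
        unfolding b_def t_def using j p
        by (intro multiplicity_decompose) auto
      then have "coprime (b j) (p ^ e)" using p prime_imp_coprime coprime_commute
        by (metis coprime_power_right_iff)
      moreover have "ord j dvd p ^ e"
        using ord_dvd_group_order[of j] j SG ord by auto
      ultimately show ?thesis by (meson coprime_divisors dvd_refl)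
    qed
    define y where "y = finprod G (\<lambda>x. x [^] b x) S"
    have y: "y \<in> carrier G" unfolding y_def using SG by (intro finprod_closed) auto
    \<comment> \<open>This power of \<open>y\<close> is the given relation, so the order of
      \<open>y\<close> is at most \<open>p ^ t\<close>; as \<open>p ^ t\<close> divides
      \<open>c j\<close>, it lies below \<open>ord j\<close>.\<close>
    have "y [^] (p ^ t) = finprod G (\<lambda>x. x [^] c x) S"
      unfolding y_def using SG
      by (subst nat_pow_finprod) (auto intro!: finprod_cong' simp: nat_pow_pow cb subset_iff)
    then have "ord y dvd p ^ t" using rel y by (simp add: pow_eq_id)
    then have "ord y \<le> p ^ t" using p by (simp add: dvd_imp_le prime_gt_0_nat)
    also have "\<dots> \<le> c j" using j by (simp add: t_def dvd_imp_le multiplicity_dvd)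
    also have "\<dots> < ord j" using c j by simp
    also have "ord j \<le> ord y"
    proof (rule exchange[OF j(1) y])
      define H where "H = generate G (insert y (S - {j}))"
      have H: "subgroup H G"
        unfolding H_def using y SG by (intro generate_is_subgroup) auto
      define r where "r = finprod G (\<lambda>x. x [^] b x) (S - {j})"
      have rH: "r \<in> H" unfolding r_def
      proof (rule subgroup_finprod_closed[OF H])
        fix x assume "x \<in> S - {j}"
        then have "x \<in> H" unfolding H_def by (auto intro: generate.incl)
        then show "x [^] b x \<in> H" using subgroup_int_pow_closed[OF H, of x "int (b x)"]
          by (simp add: int_pow_int)
      qed
      have jc: "j \<in> carrier G" using j SG by auto
      have rc: "r \<in> carrier G" using rH subgroup.mem_carrier[OF H] by blast
      have "y = j [^] b j \<otimes> r"
      proof -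
        have "y = finprod G (\<lambda>x. x [^] b x) (insert j (S - {j}))"
          using j by (simp add: y_def insert_absorb)
        also have "\<dots> = j [^] b j \<otimes> r"
          unfolding r_def using finS SG j by (subst finprod_insert) auto
        finally show ?thesis .
      qed
      then have "j [^] b j = y \<otimes> inv r"
        using jc rc y by (simp add: inv_solve_right)
      moreover have "y \<in> H" unfolding H_def by (auto intro: generate.incl)
      ultimately have "j [^] b j \<in> H"
        using rH H by (simp add: subgroup.m_closed subgroup.m_inv_closed)
      \<comment> \<open>Raising \<open>j [^] b j\<close> to an inverse of \<open>b j\<close> modulo
        \<open>ord j\<close> recovers \<open>j\<close> itself.\<close>
      moreover obtain u where u: "[b j * u = 1] (mod ord j)"
        using cong_solve_coprime_nat[OF bj] by auto
      ultimately have "(j [^] b j) [^] int u \<in> H" using H by (simp add: subgroup_int_pow_closed)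
      moreover have "(j [^] b j) [^] int u = j [^] int (b j * u)"
        using jc by (simp only: int_pow_int nat_pow_pow)
      moreover have "j [^] int (b j * u) = j [^] (1 :: int)"
        using u jc by (simp only: int_pow_eq) (metis cong_iff_dvd_diff cong_int_iff cong_sym of_nat_1)
      ultimately show "j \<in> generate G (insert y (S - {j}))" using jc by (simp add: H_def)
    qed
    finally show False by simp
  qed
  ultimately show thesis using that[of S] S by (auto simp: gen_def)
qed

text \<open>Independent generators \<open>xs\<close> give the isomorphism \<open>\<psi>\<close> from
  the product of cyclic groups: independence makes its kernel trivial, generation makes it
  surjective.\<close>

lemma invariant_factors_exist:
  assumes fin: "finite (carrier G)" and p: "prime p" and ord: "order G = p ^ e"
  shows "\<exists>ds. invariant_factors G ds"
proof -
  obtain S where SG: "S \<subseteq> carrier G" and gen: "generate G S = carrier G" and "\<one> \<notin> S"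
    and indep: "\<And>c :: 'a \<Rightarrow> nat. (\<And>x. x \<in> S \<Longrightarrow> c x < ord x) \<Longrightarrow>
       finprod G (\<lambda>x. x [^] c x) S = \<one> \<Longrightarrow> \<forall>x\<in>S. c x = 0"
    by (fact independent_generators_exist[OF fin p ord])
  obtain ys where ys: "set ys = S" "distinct ys"
    using finite_distinct_list[of S] fin SG finite_subset by blast
  \<comment> \<open>All the orders are powers of \<open>p\<close>, so sorting them by size also
    sorts them by divisibility.\<close>
  define xs where "xs = sort_key (ord) ys"
  have xs: "set xs = S" "distinct xs" using ys by (simp_all add: xs_def)
  define r where "r = length xs"
  define ds where "ds = map (ord) xs"
  have xc: "xs ! i \<in> carrier G" if "i < r" for i
    using that xs SG by (auto simp: r_def)
  have ds_nth: "ds ! i = ord (xs ! i)" if "i < r" for i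
    using that by (simp add: ds_def r_def)
  have pow: "\<exists>j. d = p ^ j" and gt: "1 < d" if d: "d \<in> set ds" for d
  proof -
    obtain x where x: "x \<in> S" "d = ord x" using d xs by (auto simp: ds_def)
    then have "d dvd p ^ e" using ord_dvd_group_order[of x] SG ord by auto
    then show "\<exists>j. d = p ^ j" by (auto simp: divides_primepow_nat[OF p])
    have "d \<noteq> 1" using x SG \<open>\<one> \<notin> S\<close> ord_eq_1[of x] by auto
    moreover have "d \<ge> 1" using x SG ord_ge_1[OF fin] by auto
    ultimately show "1 < d" by simp
  qed
  have gt': "1 < ds ! i" if "i < r" for i
    using gt[of "ds ! i"] that by (simp add: ds_def r_def)
  have "sorted ds" unfolding ds_def xs_def by simp
  then have "sorted_wrt (dvd) ds"
  proof (rule sorted_wrt_mono_rel[rotated])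
    fix x y assume "x \<in> set ds" "y \<in> set ds" "x \<le> y"
    then obtain i j where "x = p ^ i" "y = p ^ j" "p ^ i \<le> p ^ j" using pow by metis
    moreover from this have "i \<le> j" using prime_gt_1_nat[OF p] by simp
    ultimately show "x dvd y" by (simp add: le_imp_power_dvd)
  qed
  define P where "P = product_group {..<r} (\<lambda>i. integer_mod_group (ds ! i))"
  have grpP: "group P" unfolding P_def by simp
  define \<psi> where "\<psi> f = finprod G (\<lambda>i. xs ! i [^] (f i :: int)) {..<r}" for f
  have carrier: "f i \<in> {0..<int (ds ! i)}" if "f \<in> carrier P" "i < r" for f i
  proof -
    have "f i \<in> carrier (integer_mod_group (ds ! i))"
      using that by (auto simp: P_def PiE_iff)
    with gt'[OF that(2)] show ?thesis by (simp add: carrier_integer_mod_group)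
  qed
  have hom: "\<psi> \<in> hom P G"
  proof (rule homI)
    show "\<psi> f \<in> carrier G" for f
      unfolding \<psi>_def using xc by (intro finprod_closed) auto
    fix f g assume "f \<in> carrier P" "g \<in> carrier P"
    have "\<psi> (f \<otimes>\<^bsub>P\<^esub> g) = finprod G (\<lambda>i. xs ! i [^] f i \<otimes> xs ! i [^] g i) {..<r}"
      unfolding \<psi>_def
    proof (rule finprod_cong')
      fix i assume i: "i \<in> {..<r}"
      \<comment> \<open>Addition in the cyclic factor reduces modulo the order of
        \<open>xs ! i\<close>, which leaves the power unchanged.\<close>
      have "xs ! i [^] ((f i + g i) mod int (ds ! i)) = xs ! i [^] (f i + g i)"
        using xc[of i] i by (simp add: int_pow_eq ds_nth)
      then show "xs ! i [^] (f \<otimes>\<^bsub>P\<^esub> g) i = xs ! i [^] f i \<otimes> xs ! i [^] g i"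
        using i xc[of i] by (simp add: P_def int_pow_mult)
    qed (use xc in auto)
    also have "\<dots> = \<psi> f \<otimes> \<psi> g"
      unfolding \<psi>_def using xc by (intro finprod_multf) auto
    finally show "\<psi> (f \<otimes>\<^bsub>P\<^esub> g) = \<psi> f \<otimes> \<psi> g" .
  qed
  interpret \<psi>: group_hom P G \<psi>
    using hom grpP by (simp add: group_hom_def group_hom_axioms_def)
  have bij: "bij_betw ((!) xs) {..<r} S"
    using bij_betw_nth[OF xs(2) refl] xs(1) by (simp add: r_def)
  have "inj_on \<psi> (carrier P)"
    unfolding \<psi>.inj_iff_trivial_ker
  proof (rule equalityI; rule subsetI)
    fix f assume "f \<in> kernel P G \<psi>"
    then have f: "f \<in> carrier P" "\<psi> f = \<one>" by (auto simp: kernel_def)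
    \<comment> \<open>The kernel element, reindexed from positions to generators so that
      \<open>indep\<close> applies.\<close>
    define c where "c x = nat (f (the_inv_into {..<r} ((!) xs) x))" for x
    have c_nth: "c (xs ! i) = nat (f i)" if "i < r" for i
      using that bij by (simp add: c_def the_inv_into_f_f bij_betw_def)
    have "finprod G (\<lambda>x. x [^] c x) S = finprod G (\<lambda>i. (xs ! i) [^] c (xs ! i)) {..<r}"
      using finprod_reindex[of "\<lambda>x. x [^] c x" "(!) xs" "{..<r}"] bij SG
      by (auto simp: bij_betw_def)
    also have "\<dots> = \<psi> f"
      unfolding \<psi>_def
    proof (rule finprod_cong')
      fix i assume "i \<in> {..<r}"
      then show "xs ! i [^] c (xs ! i) = xs ! i [^] f i"
        using c_nth carrier[OF f(1), of i] by (simp flip: int_pow_int)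
    qed (use xc in auto)
    finally have rel: "finprod G (\<lambda>x. x [^] c x) S = \<one>" using f by simp
    have "c x < ord x" if x: "x \<in> S" for x
    proof -
      obtain i where i: "i < r" "x = xs ! i" using x bij by (auto simp: bij_betw_def)
      then show ?thesis using carrier[OF f(1) i(1)] by (simp add: c_nth ds_nth nat_less_iff)
    qed
    with indep rel have "\<forall>x\<in>S. c x = 0" by blast
    then have "f i = 0" if "i < r" for i
      using that carrier[OF f(1) that] c_nth[OF that] xs by (auto simp: r_def)
    then have "f = \<one>\<^bsub>P\<^esub>"
      using f(1) by (auto simp: P_def PiE_iff extensional_def)
    then show "f \<in> {\<one>\<^bsub>P\<^esub>}" by simp
  qed (auto simp: kernel_def)
  moreover have "\<psi> ` carrier P = carrier G"
  proof
    show "\<psi> ` carrier P \<subseteq> carrier G" by auto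
    have "S \<subseteq> \<psi> ` carrier P"
    proof
      fix x assume "x \<in> S"
      then obtain i where i: "i < r" "x = xs ! i" using bij by (auto simp: bij_betw_def)
      \<comment> \<open>The unit vector at \<open>i\<close>; its entry 1 is a reduced residue
        representative because \<open>1 < ds ! i\<close>.\<close>
      define f where "f = (\<lambda>j\<in>{..<r}. if j = i then 1 else 0 :: int)"
      have "f \<in> carrier P"
        using gt' by (auto simp: f_def P_def carrier_integer_mod_group)
      moreover have "\<psi> f = finprod G (\<lambda>j. if j = i then xs ! j else \<one>) {..<r}"
        unfolding \<psi>_def using xc by (intro finprod_cong') (auto simp: f_def)
      then have "\<psi> f = x" using finprod_singleton_swap[of i "{..<r}" "(!) xs"] i xc by auto
      ultimately show "x \<in> \<psi> ` carrier P" by blast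
    qed
    then show "carrier G \<subseteq> \<psi> ` carrier P"
      using generate_subgroup_incl[OF _ \<psi>.img_is_subgroup] gen by blast
  qed
  ultimately have "\<psi> \<in> iso P G" using hom by (simp add: iso_def bij_betw_def)
  then have "G \<cong> P" using group.iso_sym[OF grpP] by (auto simp: is_iso_def)
  then have "invariant_factors G ds"
    unfolding invariant_factors_def P_def using gt \<open>sorted_wrt (dvd) ds\<close>
    by (auto simp: ds_def r_def)
  then show ?thesis ..
qed

text \<open>The order of the group is the product of the list. For a \<open>p\<close>-group this
  makes each invariant factor a power of \<open>p\<close>, whichever list is chosen.\<close>

lemma invariant_factor_dvd_order:
  assumes ds: "invariant_factors G ds" and d: "d \<in> set ds"
  shows "d dvd order G"
proof -
  define P where "P = product_group {..<length ds} (\<lambda>i. integer_mod_group (ds ! i))"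
  have "G \<cong> P" using ds by (simp add: invariant_factors_def P_def)
  then have "order G = order P"
    unfolding Coset.order_def by (rule iso_same_card)
  also have "\<dots> = (\<Prod>i<length ds. card (carrier (integer_mod_group (ds ! i))))"
    by (simp add: Coset.order_def P_def card_PiE)
  also have "\<dots> = (\<Prod>i<length ds. ds ! i)"
    using ds by (intro prod.cong) (auto simp: carrier_integer_mod_group invariant_factors_def)
  also have "d dvd \<dots>"
    using d by (auto simp: in_set_conv_nth intro!: dvd_prodI)
  finally show ?thesis .
qed

text \<open>The coordinates are residues lifted to naturals, which turns being zero in the group
  into divisibility of sums of naturals. Injectivity of the isomorphism carries the conclusion back
  to \<open>G\<close>.\<close>

lemma invariant_factors_coordinates:
  assumes ds: "invariant_factors G ds"
  obtains \<phi> :: "nat \<Rightarrow> 'a \<Rightarrow> nat"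
    where "\<And>(c :: 's \<Rightarrow> 'a) I. finite I \<Longrightarrow> c \<in> I \<rightarrow> carrier G \<Longrightarrow>
      (\<And>i. i < length ds \<Longrightarrow> ds ! i dvd (\<Sum>s\<in>I. \<phi> i (c s))) \<Longrightarrow> finprod G c I = \<one>"
proof -
  define P where "P = product_group {..<length ds} (\<lambda>i. integer_mod_group (ds ! i))"
  have grpP: "group P" unfolding P_def by simp
  have "G \<cong> P" using ds by (simp add: invariant_factors_def P_def)
  then obtain h where h: "h \<in> iso G P" by (auto simp: is_iso_def)
  interpret h: group_hom G P h
    by (rule group_hom.intro[OF is_group grpP]) (use h in \<open>simp add: group_hom_axioms_def iso_def\<close>)
  have hc: "h x i \<in> {0..<int (ds ! i)}" if "x \<in> carrier G" "i < length ds" for x i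
  proof -
    have "ds ! i \<in> set ds" using that(2) by simp
    then have "ds ! i \<noteq> 0" using ds by (auto simp: invariant_factors_def)
    have "h x \<in> carrier P" using that by simp
    then have "h x i \<in> carrier (integer_mod_group (ds ! i))"
      using that(2) by (auto simp: P_def PiE_iff)
    with \<open>ds ! i \<noteq> 0\<close> show ?thesis by (simp add: carrier_integer_mod_group)
  qed
  define \<phi> where "\<phi> i x = nat (h x i)" for i x
  have h_finprod: "h (finprod G c I) i = (\<Sum>s\<in>I. h (c s) i) mod int (ds ! i)"
    if "finite I" "c \<in> I \<rightarrow> carrier G" "i < length ds" for c :: "'s \<Rightarrow> 'a" and I i
    using that
  proof (induction I rule: finite_induct)
    case empty
    then show ?case using h.hom_one by (simp add: P_def)
  next
    case (insert s I)
    then show ?case by (simp add: P_def mod_simps)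
  qed
  show thesis
  proof (rule that[of \<phi>])
    fix c :: "'s \<Rightarrow> 'a" and I
    assume I: "finite I" and c: "c \<in> I \<rightarrow> carrier G"
      and dvd: "\<And>i. i < length ds \<Longrightarrow> ds ! i dvd (\<Sum>s\<in>I. \<phi> i (c s))"
    have g: "finprod G c I \<in> carrier G" using c by simp
    have "h (finprod G c I) i = \<one>\<^bsub>P\<^esub> i" for i
    proof (cases "i < length ds")
      case True
      have "(\<Sum>s\<in>I. h (c s) i) = int (\<Sum>s\<in>I. \<phi> i (c s))"
        unfolding \<phi>_def of_nat_sum using hc[OF _ True] c by (intro sum.cong) auto
      with dvd[OF True] have "int (ds ! i) dvd (\<Sum>s\<in>I. h (c s) i)" by (simp del: of_nat_sum)
      then show ?thesis using h_finprod[OF I c True] True by (simp add: P_def)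
    next
      case False
      \<comment> \<open>Outside the index range all elements of the product group share the value
        \<open>undefined\<close>.\<close>
      have "h (finprod G c I) \<in> carrier P" using g by simp
      then show ?thesis using False by (simp add: P_def PiE_iff extensional_def)
    qed
    then have "h (finprod G c I) = h \<one>" by (simp add: fun_eq_iff)
    moreover have "inj_on h (carrier G)" using h by (simp add: iso_def bij_betw_def)
    ultimately show "finprod G c I = \<one>" using g by (meson inj_onD one_closed)
  qed
qed

text \<open>The pairs \<open>(d, b)\<close> are the cyclic factors of \<open>G\<close> with their coordinate functions.\<close>

lemma d_star_coordinates:
  assumes "finite (carrier G)" and p: "prime p" and ord: "order G = p ^ e"
  obtains D :: "(nat \<times> ('a \<Rightarrow> nat)) list"
    where "(\<Sum>(d, b)\<leftarrow>D. d - 1) = d_star G" "\<And>d b. (d, b) \<in> set D \<Longrightarrow> \<exists>h. d = p ^ h"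
      "\<And>(c :: 's \<Rightarrow> 'a) I. finite I \<Longrightarrow> c \<in> I \<rightarrow> carrier G \<Longrightarrow>
        (\<And>d b. (d, b) \<in> set D \<Longrightarrow> d dvd (\<Sum>s\<in>I. b (c s))) \<Longrightarrow> finprod G c I = \<one>"
proof -
  \<comment> \<open>The list picked in \<open>d_star\<close>, so that its sum is
    \<open>d_star G\<close> by unfolding; existence ensures that the choice satisfies the
    predicate.\<close>
  define ds where "ds = (SOME ds. invariant_factors G ds)"
  have ds: "invariant_factors G ds"
    unfolding ds_def using invariant_factors_exist[OF assms] by (rule someI_ex)
  obtain \<phi> :: "nat \<Rightarrow> 'a \<Rightarrow> nat" where \<phi>: "\<And>(c :: 's \<Rightarrow> 'a) I. finite I \<Longrightarrow> c \<in> I \<rightarrow> carrier G \<Longrightarrow>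
      (\<And>i. i < length ds \<Longrightarrow> ds ! i dvd (\<Sum>s\<in>I. \<phi> i (c s))) \<Longrightarrow> finprod G c I = \<one>"
    by (fact invariant_factors_coordinates[OF ds])
  define D where "D = map (\<lambda>i. (ds ! i, \<phi> i)) [0..<length ds]"
  show thesis
  proof (rule that[of D])
    have "(\<Sum>(d, b)\<leftarrow>D. d - 1) = (\<Sum>d\<leftarrow>map ((!) ds) [0..<length ds]. d - 1)"
      by (simp add: D_def comp_def)
    then show "(\<Sum>(d, b)\<leftarrow>D. d - 1) = d_star G"
      by (simp only: map_nth d_star_def ds_def)
    show "\<exists>h. d = p ^ h" if "(d, b) \<in> set D" for d b
    proof -
      have "d \<in> set ds" using that by (auto simp: D_def)
      then have "d dvd p ^ e" using invariant_factor_dvd_order[OF ds] ord by metis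
      then show ?thesis by (auto simp: divides_primepow_nat[OF p])
    qed
    show "finprod G c I = \<one>" if "finite I" "c \<in> I \<rightarrow> carrier G"
      "\<And>d b. (d, b) \<in> set D \<Longrightarrow> d dvd (\<Sum>s\<in>I. b (c s))" for c :: "'s \<Rightarrow> 'a" and I
      using that by (intro \<phi>) (auto simp: D_def)
  qed
qed

end

section \<open>Covers and zero sums\<close>

lemma sum_list_fst_map:
  "(\<Sum>(d, b)\<leftarrow>map (\<lambda>(d, b). (d, f b)) D. g d) = (\<Sum>(d, b)\<leftarrow>D. g d)"
  by (induction D) auto

text \<open>The weight \<open>1 / n s\<close> joins \<open>D\<close> as a further pair with modulus
  \<open>p ^ h\<close>. It costs only \<open>p ^ h - 1\<close> forms, so the bound
  \<open>\<le>\<close> on the cover yields the strict one required.\<close>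

lemma cover_zero_sum:
  fixes a :: "'s \<Rightarrow> int" and n :: "'s \<Rightarrow> nat" and D :: "(nat \<times> ('s \<Rightarrow> nat)) list"
  assumes p: "prime p" and S: "finite S" and n: "\<And>s. s \<in> S \<Longrightarrow> n s > 0"
    and D: "\<And>d b. (d, b) \<in> set D \<Longrightarrow> \<exists>h. d = p ^ h"
    and cover: "\<And>x. (\<Sum>(d, b)\<leftarrow>D. d - 1) + p ^ h \<le> card {s\<in>S. x \<in> residue_class (a s) (n s)}"
  shows "\<exists>I\<subseteq>S. \<exists>j>0. (\<Sum>s\<in>I. 1 / real (n s)) = real (p ^ h * j) \<and> (\<forall>(d, b)\<in>set D. d dvd sum b I)"
proof -
  define D' where "D' = (p ^ h, \<lambda>s. 1 / real (n s)) # map (\<lambda>(d, b). (d, \<lambda>s. real (b s))) D"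
  have q: "p ^ h > 0" using p by (simp add: prime_gt_0_nat)
  have sum_D': "(\<Sum>(d, b)\<leftarrow>D'. d - 1) = (p ^ h - 1) + (\<Sum>(d, b)\<leftarrow>D. d - 1)"
    unfolding D'_def list.map sum_list.Cons sum_list_fst_map by simp
  have "\<exists>I\<subseteq>S. I \<noteq> {} \<and> (\<forall>(d, b)\<in>set D'. \<exists>m. sum b I = real (d * m))"
  proof (rule exists_nonempty_subset_dvd[where D = D' and a = a, OF p S n])
    show "\<exists>h. d = p ^ h" if "(d, b) \<in> set D'" for d b
      using that D by (auto simp: D'_def)
    show "(\<Sum>(d, b)\<leftarrow>D'. d - 1) < card {s\<in>S. x \<in> residue_class (a s) (n s)}" for x
      using cover[of x] q unfolding sum_D' by linarith
    show "sum b I \<in> \<nat>" if db: "(d, b) \<in> set D'" and "I \<subseteq> S" and Z: "(\<Sum>s\<in>I. 1 / real (n s)) \<in> \<int>" for d b I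
    \<comment> \<open>For the reciprocals the sum is a nonnegative integer by the choice of
      \<open>I\<close>; every other weight takes natural values.\<close>
    proof (cases "b = (\<lambda>s. 1 / real (n s))")
      case True
      have "(\<Sum>s\<in>I. 1 / real (n s)) \<ge> 0" by (intro sum_nonneg) simp
      with Z True show ?thesis by (auto simp: Nats_altdef2)
    next
      case False
      then obtain b' where "b = (\<lambda>s. real (b' s))" using db by (auto simp: D'_def)
      then show ?thesis by (simp flip: of_nat_sum)
    qed
  qed
  then obtain I where I: "I \<subseteq> S" "I \<noteq> {}"
    and dvd': "\<forall>(d, b)\<in>set D'. \<exists>m. sum b I = real (d * m)"
    by blast
  have dvd: "\<exists>m. sum b I = real (d * m)" if "(d, b) \<in> set D'" for d b
    using bspec[OF dvd' that] by simp
  have "\<exists>j. (\<Sum>s\<in>I. 1 / real (n s)) = real (p ^ h * j)"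
    using dvd[of "p ^ h" "\<lambda>s. 1 / real (n s)"] by (simp add: D'_def)
  then obtain j where j: "(\<Sum>s\<in>I. 1 / real (n s)) = real (p ^ h * j)" ..
  \<comment> \<open>Nonemptiness of \<open>I\<close> enters here and excludes
    \<open>j = 0\<close>.\<close>
  have "(\<Sum>s\<in>I. 1 / real (n s)) > 0"
  proof (rule sum_pos)
    show "finite I" using I(1) S by (rule finite_subset)
    show "1 / real (n s) > 0" if "s \<in> I" for s using n[of s] that I(1) by auto
  qed (rule I(2))
  then have "j > 0" using j by (cases "j = 0") auto
  moreover have "d dvd sum b I" if "(d, b) \<in> set D" for d b
  proof -
    have "(d, \<lambda>s. real (b s)) \<in> set D'" using that by (force simp: D'_def)
    then obtain m where "(\<Sum>s\<in>I. real (b s)) = real (d * m)" using dvd by blast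
    then have "real (sum b I) = real (d * m)" by simp
    then have "sum b I = d * m" by (simp only: of_nat_eq_iff)
    then show ?thesis by simp
  qed
  ultimately show ?thesis using I(1) j by blast
qed

section \<open>Average of the covering function\<close>

lemma card_residue_class:
  assumes "n dvd N" and "n > 0"
  shows "card {x\<in>{..<N}. int x \<in> residue_class a n} = N div n"
proof -
  define r where "r = nat (a mod int n)"
  have r: "r < n" using assms(2) by (simp add: r_def nat_less_iff)
  obtain m where m: "N = n * m" using assms(1) ..
  have mem: "int x \<in> residue_class a n \<longleftrightarrow> x mod n = r" for x
  proof -
    have "int x \<in> residue_class a n \<longleftrightarrow> int n dvd int x - a"
      by (auto simp: residue_class_def dvd_def algebra_simps)
    also have "\<dots> \<longleftrightarrow> int x mod int n = a mod int n"
      by (simp add: mod_eq_dvd_iff)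
    also have "\<dots> \<longleftrightarrow> int (x mod n) = int r"
      using assms(2) by (simp add: r_def zmod_int)
    finally show ?thesis by simp
  qed
  have "{x\<in>{..<N}. int x \<in> residue_class a n} = (\<lambda>t. n * t + r) ` {..<m}"
  proof (rule equalityI; rule subsetI)
    fix x assume "x \<in> {x\<in>{..<N}. int x \<in> residue_class a n}"
    then have "x < n * m" "x mod n = r" by (simp_all add: mem m)
    then have "x = n * (x div n) + r" "x div n < m"
      by (metis mult_div_mod_eq, simp add: less_mult_imp_div_less mult.commute)
    then show "x \<in> (\<lambda>t. n * t + r) ` {..<m}" by blast
  next
    fix x assume "x \<in> (\<lambda>t. n * t + r) ` {..<m}"
    then obtain t where t: "t < m" "x = n * t + r" by blast
    have "n * t + r < n * Suc t" using r by simp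
    also have "\<dots> \<le> n * m" using t by (intro mult_le_mono2) simp
    finally show "x \<in> {x\<in>{..<N}. int x \<in> residue_class a n}"
      using t r by (simp add: mem m)
  qed
  moreover have "inj_on (\<lambda>t. n * t + r) {..<m}" using assms(2) by (auto simp: inj_on_def)
  ultimately show ?thesis using m assms(2) by (simp add: card_image)
qed

text \<open>Double counting: each class has \<open>N div n s\<close> members among any
  \<open>N\<close> consecutive integers. The free starting point \<open>y\<close> allows conclusions
  about single values later.\<close>

lemma sum_covering_function:
  assumes n: "\<forall>s\<in>{1..k}. n s > 0"
  obtains N :: nat where "N > 0"
    "\<And>y. (\<Sum>x<N. real (covering_function k a n (y + int x))) = N * (\<Sum>s\<in>{1..k}. 1 / real (n s))"
proof
  define N where "N = (\<Prod>s\<in>{1..k}. n s)"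
  show "N > 0" unfolding N_def using n by (intro prod_pos) auto
  fix y
  \<comment> \<open>Moving the window by \<open>y\<close> amounts to moving the residues by
    \<open>- y\<close>.\<close>
  have shift: "y + x \<in> residue_class (a s) (n s) \<longleftrightarrow> x \<in> residue_class (a s - y) (n s)" for s x
    by (auto simp: residue_class_def algebra_simps)
  have "(\<Sum>x<N. covering_function k a n (y + int x))
      = (\<Sum>x<N. \<Sum>s\<in>{1..k}. if int x \<in> residue_class (a s - y) (n s) then 1 else 0)"
    by (simp add: covering_function_def shift sum.inter_filter[symmetric])
  also have "\<dots> = (\<Sum>s\<in>{1..k}. \<Sum>x<N. if int x \<in> residue_class (a s - y) (n s) then 1 else 0)"
    by (rule sum.swap)
  also have "\<dots> = (\<Sum>s\<in>{1..k}. card {x\<in>{..<N}. int x \<in> residue_class (a s - y) (n s)})"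
    by (intro sum.cong refl) (simp only: card_eq_sum sum.inter_filter[OF finite_lessThan])
  also have "\<dots> = (\<Sum>s\<in>{1..k}. N div n s)"
    using n by (intro sum.cong refl card_residue_class) (auto simp: N_def intro!: dvd_prodI)
  finally have *: "(\<Sum>x<N. covering_function k a n (y + int x)) = (\<Sum>s\<in>{1..k}. N div n s)" .
  have "(\<Sum>x<N. real (covering_function k a n (y + int x))) = (\<Sum>s\<in>{1..k}. real (N div n s))"
    using arg_cong[OF *, of real] by simp
  also have "\<dots> = (\<Sum>s\<in>{1..k}. real N * (1 / real (n s)))"
  proof (intro sum.cong refl)
    fix s assume "s \<in> {1..k}"
    then have "n s dvd N" unfolding N_def by (intro dvd_prodI) auto
    then show "real (N div n s) = real N * (1 / real (n s))" by (simp add: real_of_nat_div)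
  qed
  finally show "(\<Sum>x<N. real (covering_function k a n (y + int x))) = N * (\<Sum>s\<in>{1..k}. 1 / real (n s))"
    by (simp add: sum_distrib_left)
qed

text \<open>The sum of reciprocals is the average of the covering function over a period. An average
  equal to the upper bound forces every value to equal it.\<close>

lemma sum_inverse_le_if_covering_le:
  assumes n: "\<forall>s\<in>{1..k}. n s > 0" and le: "\<And>x. covering_function k a n x \<le> m"
  shows "(\<Sum>s\<in>{1..k}. 1 / real (n s)) \<le> real m"
    and "(\<Sum>s\<in>{1..k}. 1 / real (n s)) = real m \<Longrightarrow> exact_cover m k a n"
proof -
  obtain N :: nat where N: "N > 0"
    and sum: "\<And>y. (\<Sum>x<N. real (covering_function k a n (y + int x))) = N * (\<Sum>s\<in>{1..k}. 1 / real (n s))"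
    using sum_covering_function[OF n] by metis
  have "N * (\<Sum>s\<in>{1..k}. 1 / real (n s)) \<le> (\<Sum>x<N. real m)"
    unfolding sum[of 0, symmetric] using le by (intro sum_mono) simp
  then show "(\<Sum>s\<in>{1..k}. 1 / real (n s)) \<le> real m" using N by simp
  assume eq: "(\<Sum>s\<in>{1..k}. 1 / real (n s)) = real m"
  show "exact_cover m k a n"
    unfolding exact_cover_def
  proof
    fix y
    \<comment> \<open>The summands are nonnegative, so all vanish; the one at \<open>x = 0\<close>
      concerns \<open>y\<close> itself.\<close>
    have "(\<Sum>x<N. real m - real (covering_function k a n (y + int x))) = 0"
      unfolding sum_subtractf sum eq by simp
    then have "\<forall>x\<in>{..<N}. real m - real (covering_function k a n (y + int x)) = 0"
      using le by (subst (asm) sum_nonneg_eq_0_iff) auto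
    with N show "covering_function k a n y = m" by fastforce
  qed
qed

lemma sum_inverse_exact_cover:
  assumes n: "\<forall>s\<in>{1..k}. n s > 0" and ex: "exact_cover m k a n"
  shows "(\<Sum>s\<in>{1..k}. 1 / real (n s)) = real m"
proof -
  obtain N :: nat where "N > 0"
    and "(\<Sum>x<N. real (covering_function k a n (0 + int x))) = N * (\<Sum>s\<in>{1..k}. 1 / real (n s))"
    using sum_covering_function[OF n] by metis
  with ex show ?thesis by (simp add: exact_cover_def)
qed

text \<open>Deleting one class costs at most 1 in each covering number, yet pushes the total weight
  strictly below \<open>m\<close>, so that no subset can have weight \<open>m\<close>.\<close>

lemma exact_cover_remove1:
  assumes n: "\<forall>s\<in>{1..k}. n s > 0" and ex: "exact_cover m k a n" and m: "m > 0"
  shows "m - 1 \<le> card {s\<in>{1..k} - {1}. x \<in> residue_class (a s) (n s)}"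
    and "(\<Sum>s\<in>{1..k} - {1}. 1 / real (n s)) < real m"
proof -
  have "m = card {s\<in>{1..k}. x \<in> residue_class (a s) (n s)}"
    using ex by (simp add: exact_cover_def covering_function_def)
  also have "\<dots> \<le> card (insert 1 {s\<in>{1..k} - {1}. x \<in> residue_class (a s) (n s)})"
    by (intro card_mono) auto
  also have "\<dots> \<le> Suc (card {s\<in>{1..k} - {1}. x \<in> residue_class (a s) (n s)})"
    by (rule card_insert_le_m1) auto
  finally show "m - 1 \<le> card {s\<in>{1..k} - {1}. x \<in> residue_class (a s) (n s)}" by simp
  have total: "(\<Sum>s\<in>{1..k}. 1 / real (n s)) = real m" by (rule sum_inverse_exact_cover[OF n ex])
  \<comment> \<open>A positive total weight means that there is a class to delete.\<close>
  with m have k: "1 \<in> {1..k}" by (cases k) auto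
  then have "real m = 1 / real (n 1) + (\<Sum>s\<in>{1..k} - {1}. 1 / real (n s))"
    unfolding total[symmetric] by (intro sum.remove) auto
  with bspec[OF n k] show "(\<Sum>s\<in>{1..k} - {1}. 1 / real (n s)) < real m" by simp
qed

section \<open>Direct products\<close>

lemma DirProd_comm_group:
  assumes "comm_group G" "comm_group H"
  shows "comm_group (G \<times>\<times> H)"
proof -
  interpret G: comm_group G by fact
  interpret H: comm_group H by fact
  show ?thesis
    by (rule group.group_comm_groupI)
      (auto simp: G.m_comm H.m_comm intro: DirProd_group G.is_group H.is_group)
qed

lemma finprod_DirProd:
  assumes "comm_group G" "comm_group H" and "c \<in> I \<rightarrow> carrier (G \<times>\<times> H)"
  shows "finprod (G \<times>\<times> H) c I = (finprod G (fst \<circ> c) I, finprod H (snd \<circ> c) I)"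
proof -
  interpret G: comm_group G by fact
  interpret H: comm_group H by fact
  interpret GH: comm_group "G \<times>\<times> H" by (rule DirProd_comm_group) fact+
  show ?thesis using assms(3)
  proof (induction I rule: infinite_finite_induct)
    case (insert s I)
    have "c s \<in> carrier G \<times> carrier H" using insert.prems by auto
    moreover have "(\<lambda>s. fst (c s)) \<in> I \<rightarrow> carrier G" "(\<lambda>s. snd (c s)) \<in> I \<rightarrow> carrier H"
      using insert.prems by (auto simp: Pi_iff mem_Times_iff)
    ultimately show ?case using insert by (auto simp: mult_DirProd' mem_Times_iff)
  qed auto
qed

theorem theorem2p2:
  fixes p q :: nat and G :: "('g, 'm) monoid_scheme"
  assumes "Factorial_Ring.prime p"
    and "comm_group G" and "finite (carrier G)" and "\<exists>e::nat. order G = p ^ e"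
    and "\<exists>h::nat. q = p ^ h" and "q > d_star G"
  shows
    "(\<forall>(k::nat) (a :: nat \<Rightarrow> int) (n :: nat \<Rightarrow> nat) (c :: nat \<Rightarrow> 'g).
        (\<forall>s\<in>{1..k}. n s > 0) \<longrightarrow>
        (\<forall>x. d_star G + q \<le> covering_function k a n x \<and> covering_function k a n x \<le> 2 * q) \<longrightarrow>
        (\<forall>s\<in>{1..k}. c s \<in> carrier G) \<longrightarrow>
        (\<exists>I\<subseteq>{1..k}. finprod G c I = \<one>\<^bsub>G\<^esub> \<and> (\<Sum>s\<in>I. 1 / real (n s)) = real q))
     \<and>
     (\<forall>(k::nat) (a :: nat \<Rightarrow> int) (n :: nat \<Rightarrow> nat) (c :: nat \<Rightarrow> 'g \<times> 'g).
        (\<forall>s\<in>{1..k}. n s > 0) \<longrightarrow>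
        exact_cover (3 * q) k a n \<longrightarrow>
        (\<forall>s\<in>{1..k}. c s \<in> carrier (G \<times>\<times> G)) \<longrightarrow>
        finprod (G \<times>\<times> G) c {1..k} = \<one>\<^bsub>G \<times>\<times> G\<^esub> \<longrightarrow>
        (\<exists>I\<subseteq>{1..k}. finprod (G \<times>\<times> G) c I = \<one>\<^bsub>G \<times>\<times> G\<^esub> \<and> (\<Sum>s\<in>I. 1 / real (n s)) = real q))"
proof -
  note p = assms(1)
  interpret G: comm_group G by fact
  interpret GG: comm_group "G \<times>\<times> G" by (rule DirProd_comm_group) fact+
  obtain e where e: "order G = p ^ e" using assms(4) ..
  obtain h where q: "q = p ^ h" using assms(5) ..
  obtain D :: "(nat \<times> ('g \<Rightarrow> nat)) list" where D_sum: "(\<Sum>(d, b)\<leftarrow>D. d - 1) = d_star G"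
    and D_pow: "\<And>d b. (d, b) \<in> set D \<Longrightarrow> \<exists>h. d = p ^ h"
    and D_one: "\<And>(c :: nat \<Rightarrow> 'g) I. finite I \<Longrightarrow> c \<in> I \<rightarrow> carrier G \<Longrightarrow>
        (\<And>d b. (d, b) \<in> set D \<Longrightarrow> d dvd (\<Sum>s\<in>I. b (c s))) \<Longrightarrow> finprod G c I = \<one>\<^bsub>G\<^esub>"
    by (fact G.d_star_coordinates[OF assms(3) p e])
  have coords_sum: "(\<Sum>(d, b)\<leftarrow>map (\<lambda>(d, b). (d, \<lambda>s. b (c s))) D. d - 1) = d_star G" for c :: "nat \<Rightarrow> 'g"
    unfolding sum_list_fst_map by (rule D_sum)
  have q0: "q > 0" using assms(6) by simp
  show ?thesis
  proof (intro conjI allI impI)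

    \<comment> \<open>Part (i): covering numbers between \<open>d_star G + q\<close> and
      \<open>2 * q\<close>\<close>
    fix k :: nat and a :: "nat \<Rightarrow> int" and n :: "nat \<Rightarrow> nat" and c :: "nat \<Rightarrow> 'g"
    assume n: "\<forall>s\<in>{1..k}. n s > 0" and c: "\<forall>s\<in>{1..k}. c s \<in> carrier G"
      and w: "\<forall>x. d_star G + q \<le> covering_function k a n x \<and> covering_function k a n x \<le> 2 * q"
    \<comment> \<open>Total weight below \<open>2 * q\<close> will exclude weight
      \<open>2 * q\<close> for the zero-sum set. All classes are kept unless the cover is exact;
      then one is deleted.\<close>
    have "\<exists>S\<subseteq>{1..k}. (\<Sum>s\<in>S. 1 / real (n s)) < real (2 * q) \<and>
      (\<forall>x. d_star G + q \<le> card {s\<in>S. x \<in> residue_class (a s) (n s)})"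
    proof (cases "(\<Sum>s\<in>{1..k}. 1 / real (n s)) = real (2 * q)")
      case True
      then have ex: "exact_cover (2 * q) k a n"
        using sum_inverse_le_if_covering_le(2)[OF n, of a "2 * q"] w by blast
      have "d_star G + q \<le> card {s\<in>{1..k} - {1}. x \<in> residue_class (a s) (n s)}" for x
        \<comment> \<open>Since \<open>d_star G < q\<close>, the remaining \<open>2 * q - 1\<close>
          is still at least \<open>d_star G + q\<close>.\<close>
        using exact_cover_remove1(1)[OF n ex, of x] assms(6) by linarith
      moreover have "(\<Sum>s\<in>{1..k} - {1}. 1 / real (n s)) < real (2 * q)"
        using exact_cover_remove1(2)[OF n ex] q0 by linarith
      ultimately show ?thesis by blast
    next
      case False
      moreover have "(\<Sum>s\<in>{1..k}. 1 / real (n s)) \<le> real (2 * q)"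
        using w by (intro sum_inverse_le_if_covering_le(1)[OF n, of a]) blast
      ultimately have "(\<Sum>s\<in>{1..k}. 1 / real (n s)) < real (2 * q)" by linarith
      then show ?thesis using w unfolding covering_function_def by blast
    qed
    then obtain S where S: "S \<subseteq> {1..k}" and S_less: "(\<Sum>s\<in>S. 1 / real (n s)) < real (2 * q)"
      and S_cover: "\<And>x. d_star G + q \<le> card {s\<in>S. x \<in> residue_class (a s) (n s)}"
      by blast
    have finS: "finite S" using S by (rule finite_subset) simp
    have "\<exists>I\<subseteq>S. \<exists>j>0. (\<Sum>s\<in>I. 1 / real (n s)) = real (p ^ h * j) \<and>
        (\<forall>(d, b)\<in>set (map (\<lambda>(d, b). (d, \<lambda>s. b (c s))) D). d dvd sum b I)"
    proof (rule cover_zero_sum[where a = a, OF p finS])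
      show "n s > 0" if "s \<in> S" for s using that n S by auto
      show "\<exists>h. d = p ^ h" if "(d, b) \<in> set (map (\<lambda>(d, b). (d, \<lambda>s. b (c s))) D)" for d b
        using that D_pow by auto
    qed (use S_cover in \<open>simp only: coords_sum q\<close>)
    then obtain I j where I: "I \<subseteq> S" "j > 0" "(\<Sum>s\<in>I. 1 / real (n s)) = real (p ^ h * j)"
      and dvd': "\<forall>(d, b)\<in>set (map (\<lambda>(d, b). (d, \<lambda>s. b (c s))) D). d dvd sum b I"
      by blast
    have dvd: "d dvd (\<Sum>s\<in>I. b (c s))" if "(d, b) \<in> set D" for d b
      using dvd' that by fastforce
    have "(\<Sum>s\<in>I. 1 / real (n s)) \<le> (\<Sum>s\<in>S. 1 / real (n s))"
      using I finS by (intro sum_mono2) auto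
    with S_less have "real (q * j) < real (2 * q)" by (simp add: I(3) q)
    \<comment> \<open>The weight of \<open>I\<close> is a positive multiple of \<open>q\<close>
      below \<open>2 * q\<close>, hence \<open>q\<close>.\<close>
    then have "q * j < q * 2" by linarith
    then have "j = 1" using I(2) by simp
    moreover have "finprod G c I = \<one>\<^bsub>G\<^esub>"
    proof (rule D_one)
      show "finite I" using I finS by (auto intro: finite_subset)
      show "c \<in> I \<rightarrow> carrier G" using I S c by auto
    qed (rule dvd)
    ultimately show "\<exists>I\<subseteq>{1..k}. finprod G c I = \<one>\<^bsub>G\<^esub> \<and> (\<Sum>s\<in>I. 1 / real (n s)) = real q"
      using I S by (intro exI[of _ I]) (auto simp: q)
  next

    \<comment> \<open>Part (ii): exact \<open>3 * q\<close>-covers and the square of the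
      group\<close>
    fix k :: nat and a :: "nat \<Rightarrow> int" and n :: "nat \<Rightarrow> nat" and c :: "nat \<Rightarrow> 'g \<times> 'g"
    assume n: "\<forall>s\<in>{1..k}. n s > 0" and ex: "exact_cover (3 * q) k a n"
      and c: "\<forall>s\<in>{1..k}. c s \<in> carrier (G \<times>\<times> G)"
      and total: "finprod (G \<times>\<times> G) c {1..k} = \<one>\<^bsub>G \<times>\<times> G\<^esub>"
    define S where "S = {1..k} - {1}"
    \<comment> \<open>The coordinates of both components, at a total cost of
      \<open>2 * d_star G\<close> forms.\<close>
    define E where "E = map (\<lambda>(d, b). (d, \<lambda>s. b (fst (c s)))) D @ map (\<lambda>(d, b). (d, \<lambda>s. b (snd (c s)))) D"
    have E_sum: "(\<Sum>(d, b)\<leftarrow>E. d - 1) = 2 * d_star G"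
      unfolding E_def map_append sum_list_append sum_list_fst_map D_sum by simp
    have S: "(\<Sum>s\<in>S. 1 / real (n s)) < real (3 * q)"
      "\<And>x. 3 * q - 1 \<le> card {s\<in>S. x \<in> residue_class (a s) (n s)}"
      using exact_cover_remove1[OF n ex] q0 by (simp_all add: S_def)
    have "\<exists>I\<subseteq>S. \<exists>j>0. (\<Sum>s\<in>I. 1 / real (n s)) = real (p ^ h * j) \<and> (\<forall>(d, b)\<in>set E. d dvd sum b I)"
    proof (rule cover_zero_sum[where a = a, OF p])
      show "finite S" "\<And>s. s \<in> S \<Longrightarrow> n s > 0" using n by (auto simp: S_def)
      show "\<exists>h. d = p ^ h" if "(d, b) \<in> set E" for d b using that D_pow by (auto simp: E_def)
      show "(\<Sum>(d, b)\<leftarrow>E. d - 1) + p ^ h \<le> card {s\<in>S. x \<in> residue_class (a s) (n s)}" for x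
        \<comment> \<open>From \<open>d_star G \<le> q - 1\<close> the required number is at most
          \<open>3 * q - 2\<close>, which fits below the \<open>3 * q - 1\<close> left after the
          deletion.\<close>
        using S(2)[of x] assms(6) unfolding E_sum q[symmetric] by linarith
    qed
    then obtain I j where I: "I \<subseteq> S" "j > 0" "(\<Sum>s\<in>I. 1 / real (n s)) = real (p ^ h * j)"
      and dvd': "\<forall>(d, b)\<in>set E. d dvd sum b I"
      by blast
    have dvd: "d dvd sum b I" if "(d, b) \<in> set E" for d b
      using bspec[OF dvd' that] by simp
    have Ik: "I \<subseteq> {1..k}" and finI: "finite I" using I(1) by (auto simp: S_def intro: finite_subset)
    have cI: "c \<in> I \<rightarrow> carrier (G \<times>\<times> G)" using Ik c by auto
    have "finprod G (fst \<circ> c) I = \<one>\<^bsub>G\<^esub>" "finprod G (snd \<circ> c) I = \<one>\<^bsub>G\<^esub>"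
    proof (rule_tac [!] D_one)
      show "fst \<circ> c \<in> I \<rightarrow> carrier G" "snd \<circ> c \<in> I \<rightarrow> carrier G"
        using cI by (auto simp: Pi_iff mem_Times_iff)
      show "d dvd (\<Sum>s\<in>I. b ((fst \<circ> c) s))" "d dvd (\<Sum>s\<in>I. b ((snd \<circ> c) s))" if "(d, b) \<in> set D" for d b
        using that by (auto intro!: dvd simp: E_def)
    qed (use finI in auto)
    then have one: "finprod (G \<times>\<times> G) c I = \<one>\<^bsub>G \<times>\<times> G\<^esub>"
      by (simp add: finprod_DirProd[OF assms(2,2) cI])
    have "(\<Sum>s\<in>I. 1 / real (n s)) \<le> (\<Sum>s\<in>S. 1 / real (n s))"
      using I by (intro sum_mono2) (auto simp: S_def)
    with S(1) have "real (q * j) < real (3 * q)" by (simp add: I(3) q)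
    then have "q * j < q * 3" by linarith
    then consider "j = 1" | "j = 2" using I(2) by fastforce
    then show "\<exists>I\<subseteq>{1..k}. finprod (G \<times>\<times> G) c I = \<one>\<^bsub>G \<times>\<times> G\<^esub> \<and> (\<Sum>s\<in>I. 1 / real (n s)) = real q"
    proof cases
      case 1
      with I Ik one show ?thesis by (intro exI[of _ I]) (auto simp: q)
    next
      case 2
      \<comment> \<open>The complement is taken in all of \<open>{1..k}\<close>, including the
        deleted class: it has weight \<open>3 * q - 2 * q\<close>, and it is zero-sum because both
        the whole family and \<open>I\<close> are.\<close>
      define J where "J = {1..k} - I"
      have split: "{1..k} = I \<union> J" "I \<inter> J = {}" "finite J" using Ik by (auto simp: J_def)
      have cJ: "c \<in> J \<rightarrow> carrier (G \<times>\<times> G)" using c by (auto simp: J_def)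
      have "finprod (G \<times>\<times> G) c {1..k} = finprod (G \<times>\<times> G) c I \<otimes>\<^bsub>G \<times>\<times> G\<^esub> finprod (G \<times>\<times> G) c J"
        unfolding split(1) using split finI cI cJ by (intro GG.finprod_Un_disjoint) auto
      also have "\<dots> = finprod (G \<times>\<times> G) c J"
        unfolding one using cJ by (intro GG.l_one GG.finprod_closed)
      finally have "finprod (G \<times>\<times> G) c J = \<one>\<^bsub>G \<times>\<times> G\<^esub>" using total by simp
      moreover have "(\<Sum>s\<in>{1..k}. 1 / real (n s)) = (\<Sum>s\<in>I. 1 / real (n s)) + (\<Sum>s\<in>J. 1 / real (n s))"
        unfolding split(1) using split finI by (intro sum.union_disjoint) auto
      then have "(\<Sum>s\<in>J. 1 / real (n s)) = real q"
        using sum_inverse_exact_cover[OF n ex] I(3) 2 by (simp add: q)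
      ultimately show ?thesis by (intro exI[of _ J]) (auto simp: J_def)
    qed
  qed
qed

end
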